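(* For every $n\ge 1$, the blocked braid $SBR\in\mathbf{BB}_n$ determines the underlying permutation of the braid $B$, and hence there is a surjective group homomorphism $\mathbf{BB}_n\to\Sigma_n$ onto the symmetric group on $n$ letters, sending each $SBR$ to the permutation underlying $B$ (so that $S\sigma_iR$ is sent to the transposition $(i\ \ i+1)$).
   Context: Composition of arrows is written by juxtaposition, $fg$ meaning first $g$, then $f$. A braided strict monoidal category is a category with a strictly associative and unitary tensor functor $\otimes$ with unit $I$, and a natural family of isomorphisms (twist) $\tau_{A,B}:A\otimes B\to B\otimes A$ such that $\tau_{A,B\otimes C}=(1_B\otimes\tau_{A,C})(\tau_{A,B}\otimes 1_C)$ and $\tau_{A\otimes B,C}=(\tau_{A,C}\otimes 1_B)(1_A\otimes\tau_{B,C})$. $A^n$ denotes the $n$-fold tensor power of $A$. A tangle algebra in such a category is an object $A$ with arrows $\eta:I\to A\otimes A$ and $\epsilon:A\otimes A\to I$ satisfying $(\epsilon\otimes 1_A)(1_A\otimes\eta)=1_A=(1_A\otimes\epsilon)(\eta\otimes 1_A)$, $\epsilon\tau_{A,A}=\epsilon$ and $\tau_{A,A}\eta=\eta$. $\mathbf{Tangle}_n$ is the free braided strict monoidal category generated by an object $A$ with a tangle algebra structure and two arrows $R:I\to A^n$ and $S:A^n\to I$ (subject to no further equations). A braid in $\mathbf{Tangle}_n$ is an arrow $B:A^n\to A^n$ that is a composite of arrows each of which is a tensor of identities and arrows $\tau_{A,A}$ or $\tau_{A,A}^{-1}$. For $1\le i<n$, $\sigma_i=1_{A^{i-1}}\otimes\tau_{A,A}\otimes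 1_{A^{n-i-1}}$. The permutation underlying a braid $B$, written as a composite of arrows $\sigma_i^{\pm1}$, is the permutation obtained by replacing each $\sigma_i^{\pm 1}$ by the transposition $(i\ \ i+1)$. A blocked braid on $n$ strings is an arrow $I\to I$ of $\mathbf{Tangle}_n$ of the form $SBR$ with $B$ a braid; equality of blocked braids is equality of arrows in $\mathbf{Tangle}_n$. The blocked-braid group $\mathbf{BB}_n$ has as elements the blocked braids on $n$ strings, identity $S1_{A^n}R$, product $(SBR)(SB'R)=SBB'R$ and inverse $(SBR)^{-1}=SB^{-1}R$ (these operations are well defined). *)

theory Defs
  imports "HOL-Algebra.Sym_Groups"
begin

section \<open>Braided strict monoidal categories\<close>

text \<open>Composition is written as in \<open>f \<bullet> g\<close>: first \<open>g\<close>, then \<open>f\<close>.\<close>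

record ('o, 'a) bcat =
  Ob :: "'o set"
  Arr :: "'a set"
  Dom :: "'a \<Rightarrow> 'o"
  Cod :: "'a \<Rightarrow> 'o"
  Idn :: "'o \<Rightarrow> 'a"
  Cmp :: "'a \<Rightarrow> 'a \<Rightarrow> 'a"  (infixl "\<bullet>\<index>" 65)
  Unit :: "'o"
  TenO :: "'o \<Rightarrow> 'o \<Rightarrow> 'o"  (infixl "\<star>\<index>" 75)
  Ten :: "'a \<Rightarrow> 'a \<Rightarrow> 'a"  (infixl "\<boxtimes>\<index>" 70)
  Tau :: "'o \<Rightarrow> 'o \<Rightarrow> 'a"

definition Hom :: "('o, 'a) bcat \<Rightarrow> 'o \<Rightarrow> 'o \<Rightarrow> 'a set" where
  "Hom C a b = {f \<in> Arr C. Dom C f = a \<and> Cod C f = b}"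

definition is_inverse :: "('o, 'a) bcat \<Rightarrow> 'a \<Rightarrow> 'a \<Rightarrow> bool" where
  "is_inverse C f g \<longleftrightarrow> g \<in> Hom C (Cod C f) (Dom C f) \<and>
     f \<bullet>\<^bsub>C\<^esub> g = Idn C (Cod C f) \<and> g \<bullet>\<^bsub>C\<^esub> f = Idn C (Dom C f)"

definition inv_arr :: "('o, 'a) bcat \<Rightarrow> 'a \<Rightarrow> 'a" where
  "inv_arr C f = (THE g. is_inverse C f g)"

fun tpow :: "('o, 'a) bcat \<Rightarrow> 'o \<Rightarrow> nat \<Rightarrow> 'o" where
  "tpow C A 0 = Unit C"
| "tpow C A (Suc k) = A \<star>\<^bsub>C\<^esub> tpow C A k"

locale braided_strict_monoidal_category =
  fixes C :: "('o, 'a) bcat" (structure)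
  assumes dom_cod: "f \<in> Arr C \<Longrightarrow> Dom C f \<in> Ob C" "f \<in> Arr C \<Longrightarrow> Cod C f \<in> Ob C"
    and idn_hom: "a \<in> Ob C \<Longrightarrow> Idn C a \<in> Hom C a a"
    and cmp_hom: "\<lbrakk>f \<in> Hom C b c; g \<in> Hom C a b\<rbrakk> \<Longrightarrow> f \<bullet> g \<in> Hom C a c"
    and cmp_assoc: "\<lbrakk>f \<in> Hom C c d; g \<in> Hom C b c; h \<in> Hom C a b\<rbrakk> \<Longrightarrow>
          (f \<bullet> g) \<bullet> h = f \<bullet> (g \<bullet> h)"
    and cmp_idn: "f \<in> Hom C a b \<Longrightarrow> Idn C b \<bullet> f = f" "f \<in> Hom C a b \<Longrightarrow> f \<bullet> Idn C a = f"
    and unit_ob: "Unit C \<in> Ob C"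
    and tenO_ob: "\<lbrakk>a \<in> Ob C; b \<in> Ob C\<rbrakk> \<Longrightarrow> a \<star> b \<in> Ob C"
    and tenO_assoc: "\<lbrakk>a \<in> Ob C; b \<in> Ob C; c \<in> Ob C\<rbrakk> \<Longrightarrow> (a \<star> b) \<star> c = a \<star> (b \<star> c)"
    and tenO_unit: "a \<in> Ob C \<Longrightarrow> Unit C \<star> a = a" "a \<in> Ob C \<Longrightarrow> a \<star> Unit C = a"
    and ten_hom: "\<lbrakk>f \<in> Hom C a b; g \<in> Hom C c d\<rbrakk> \<Longrightarrow> f \<boxtimes> g \<in> Hom C (a \<star> c) (b \<star> d)"
    and ten_idn: "\<lbrakk>a \<in> Ob C; b \<in> Ob C\<rbrakk> \<Longrightarrow> Idn C a \<boxtimes> Idn C b = Idn C (a \<star> b)"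
    and ten_cmp: "\<lbrakk>f \<in> Hom C b c; g \<in> Hom C a b; h \<in> Hom C b' c'; k \<in> Hom C a' b'\<rbrakk> \<Longrightarrow>
          (f \<bullet> g) \<boxtimes> (h \<bullet> k) = (f \<boxtimes> h) \<bullet> (g \<boxtimes> k)"
    and ten_assoc: "\<lbrakk>f \<in> Arr C; g \<in> Arr C; h \<in> Arr C\<rbrakk> \<Longrightarrow> (f \<boxtimes> g) \<boxtimes> h = f \<boxtimes> (g \<boxtimes> h)"
    and ten_unit: "f \<in> Arr C \<Longrightarrow> Idn C (Unit C) \<boxtimes> f = f"
          "f \<in> Arr C \<Longrightarrow> f \<boxtimes> Idn C (Unit C) = f"
    and tau_hom: "\<lbrakk>a \<in> Ob C; b \<in> Ob C\<rbrakk> \<Longrightarrow> Tau C a b \<in> Hom C (a \<star> b) (b \<star> a)"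
    and tau_iso: "\<lbrakk>a \<in> Ob C; b \<in> Ob C\<rbrakk> \<Longrightarrow> \<exists>g. is_inverse C (Tau C a b) g"
    and tau_natural: "\<lbrakk>f \<in> Hom C a b; g \<in> Hom C c d\<rbrakk> \<Longrightarrow>
          Tau C b d \<bullet> (f \<boxtimes> g) = (g \<boxtimes> f) \<bullet> Tau C a c"
    and tau_tenO_right: "\<lbrakk>a \<in> Ob C; b \<in> Ob C; c \<in> Ob C\<rbrakk> \<Longrightarrow>
          Tau C a (b \<star> c) = (Idn C b \<boxtimes> Tau C a c) \<bullet> (Tau C a b \<boxtimes> Idn C c)"
    and tau_tenO_left: "\<lbrakk>a \<in> Ob C; b \<in> Ob C; c \<in> Ob C\<rbrakk> \<Longrightarrow>
          Tau C (a \<star> b) c = (Tau C a c \<boxtimes> Idn C b) \<bullet> (Idn C a \<boxtimes> Tau C b c)"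

locale tangle_algebra = braided_strict_monoidal_category +
  fixes A :: 'a and \<eta> \<epsilon> :: 'b
  assumes A_ob: "A \<in> Ob C"
    and eta_hom: "\<eta> \<in> Hom C (Unit C) (A \<star> A)"
    and eps_hom: "\<epsilon> \<in> Hom C (A \<star> A) (Unit C)"
    and snake: "(\<epsilon> \<boxtimes> Idn C A) \<bullet> (Idn C A \<boxtimes> \<eta>) = Idn C A"
               "(Idn C A \<boxtimes> \<epsilon>) \<bullet> (\<eta> \<boxtimes> Idn C A) = Idn C A"
    and eps_tau: "\<epsilon> \<bullet> Tau C A A = \<epsilon>"
    and tau_eta: "Tau C A A \<bullet> \<eta> = \<eta>"

locale blocked_tangle_algebra = tangle_algebra +
  fixes n :: nat and R S :: 'b
  assumes R_hom: "R \<in> Hom C (Unit C) (tpow C A n)"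
    and S_hom: "S \<in> Hom C (tpow C A n) (Unit C)"

definition strict_braided_functor ::
  "('o, 'a) bcat \<Rightarrow> ('p, 'b) bcat \<Rightarrow> ('o \<Rightarrow> 'p) \<Rightarrow> ('a \<Rightarrow> 'b) \<Rightarrow> bool" where
  "strict_braided_functor C D F G \<longleftrightarrow>
     (\<forall>a \<in> Ob C. F a \<in> Ob D) \<and>
     (\<forall>f \<in> Arr C. G f \<in> Hom D (F (Dom C f)) (F (Cod C f))) \<and>
     (\<forall>a \<in> Ob C. G (Idn C a) = Idn D (F a)) \<and>
     (\<forall>f \<in> Arr C. \<forall>g \<in> Arr C. Dom C f = Cod C g \<longrightarrow> G (f \<bullet>\<^bsub>C\<^esub> g) = G f \<bullet>\<^bsub>D\<^esub> G g) \<and>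
     F (Unit C) = Unit D \<and>
     (\<forall>a \<in> Ob C. \<forall>b \<in> Ob C. F (a \<star>\<^bsub>C\<^esub> b) = F a \<star>\<^bsub>D\<^esub> F b) \<and>
     (\<forall>f \<in> Arr C. \<forall>g \<in> Arr C. G (f \<boxtimes>\<^bsub>C\<^esub> g) = G f \<boxtimes>\<^bsub>D\<^esub> G g) \<and>
     (\<forall>a \<in> Ob C. \<forall>b \<in> Ob C. G (Tau C a b) = Tau D (F a) (F b))"


section \<open>The free category on a tangle algebra and two arrows R, S\<close>

text \<open>Objects are the tensor powers of the generating object, that is, natural numbers;
  arrows are well-formed expressions modulo the congruence generated by the axioms.
  That this is the free such category is the content of \<open>Tangle_model\<close> and \<open>Tangle_free\<close> below.\<close>

datatype expr =
    EId nat
  | ECmp expr expr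
  | ETen expr expr
  | ETau nat nat
  | ETauInv nat nat
  | EEta
  | EEps
  | ER
  | ES

fun src :: "nat \<Rightarrow> expr \<Rightarrow> nat" where
  "src n (EId k) = k"
| "src n (ECmp f g) = src n g"
| "src n (ETen f g) = src n f + src n g"
| "src n (ETau j k) = j + k"
| "src n (ETauInv j k) = k + j"
| "src n EEta = 0"
| "src n EEps = 2"
| "src n ER = 0"
| "src n ES = n"

fun tgt :: "nat \<Rightarrow> expr \<Rightarrow> nat" where
  "tgt n (EId k) = k"
| "tgt n (ECmp f g) = tgt n f"
| "tgt n (ETen f g) = tgt n f + tgt n g"
| "tgt n (ETau j k) = k + j"
| "tgt n (ETauInv j k) = j + k"
| "tgt n EEta = 2"
| "tgt n EEps = 0"
| "tgt n ER = n"
| "tgt n ES = 0"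

fun wfe :: "nat \<Rightarrow> expr \<Rightarrow> bool" where
  "wfe n (ECmp f g) \<longleftrightarrow> wfe n f \<and> wfe n g \<and> src n f = tgt n g"
| "wfe n (ETen f g) \<longleftrightarrow> wfe n f \<and> wfe n g"
| "wfe n _ \<longleftrightarrow> True"

inductive eqv :: "nat \<Rightarrow> expr \<Rightarrow> expr \<Rightarrow> bool" for n where
  eqv_refl: "wfe n f \<Longrightarrow> eqv n f f"
| eqv_sym: "eqv n f g \<Longrightarrow> eqv n g f"
| eqv_trans: "eqv n f g \<Longrightarrow> eqv n g h \<Longrightarrow> eqv n f h"
| eqv_cmp: "eqv n f f' \<Longrightarrow> eqv n g g' \<Longrightarrow> src n f = tgt n g \<Longrightarrow> eqv n (ECmp f g) (ECmp f' g')"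
| eqv_ten: "eqv n f f' \<Longrightarrow> eqv n g g' \<Longrightarrow> eqv n (ETen f g) (ETen f' g')"
| cmp_assoc: "wfe n (ECmp (ECmp f g) h) \<Longrightarrow> eqv n (ECmp (ECmp f g) h) (ECmp f (ECmp g h))"
| id_left: "wfe n f \<Longrightarrow> eqv n (ECmp (EId (tgt n f)) f) f"
| id_right: "wfe n f \<Longrightarrow> eqv n (ECmp f (EId (src n f))) f"
| ten_id: "eqv n (ETen (EId j) (EId k)) (EId (j + k))"
| ten_cmp: "wfe n (ECmp f g) \<Longrightarrow> wfe n (ECmp h k) \<Longrightarrow>
    eqv n (ETen (ECmp f g) (ECmp h k)) (ECmp (ETen f h) (ETen g k))"
| ten_assoc: "wfe n f \<Longrightarrow> wfe n g \<Longrightarrow> wfe n h \<Longrightarrow>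
    eqv n (ETen (ETen f g) h) (ETen f (ETen g h))"
| unit_left: "wfe n f \<Longrightarrow> eqv n (ETen (EId 0) f) f"
| unit_right: "wfe n f \<Longrightarrow> eqv n (ETen f (EId 0)) f"
| tau_inv_left: "eqv n (ECmp (ETauInv j k) (ETau j k)) (EId (j + k))"
| tau_inv_right: "eqv n (ECmp (ETau j k) (ETauInv j k)) (EId (k + j))"
| tau_natural: "wfe n f \<Longrightarrow> wfe n g \<Longrightarrow>
    eqv n (ECmp (ETau (tgt n f) (tgt n g)) (ETen f g))
          (ECmp (ETen g f) (ETau (src n f) (src n g)))"
| tau_right: "eqv n (ETau i (j + k))
    (ECmp (ETen (EId j) (ETau i k)) (ETen (ETau i j) (EId k)))"
| tau_left: "eqv n (ETau (i + j) k)
    (ECmp (ETen (ETau i k) (EId j)) (ETen (EId i) (ETau j k)))"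
| snake_left: "eqv n (ECmp (ETen EEps (EId 1)) (ETen (EId 1) EEta)) (EId 1)"
| snake_right: "eqv n (ECmp (ETen (EId 1) EEps) (ETen EEta (EId 1))) (EId 1)"
| eps_tau: "eqv n (ECmp EEps (ETau 1 1)) EEps"
| tau_eta: "eqv n (ECmp (ETau 1 1) EEta) EEta"

definition cls :: "nat \<Rightarrow> expr \<Rightarrow> expr set" where
  "cls n f = {g. eqv n f g}"

definition rep :: "expr set \<Rightarrow> expr" where
  "rep X = (SOME f. f \<in> X)"

definition Tangle :: "nat \<Rightarrow> (nat, expr set) bcat" where
  "Tangle n = \<lparr>
     Ob = UNIV,
     Arr = cls n ` {f. wfe n f},
     Dom = (\<lambda>X. src n (rep X)),
     Cod = (\<lambda>X. tgt n (rep X)),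
     Idn = (\<lambda>k. cls n (EId k)),
     Cmp = (\<lambda>X Y. cls n (ECmp (rep X) (rep Y))),
     Unit = 0,
     TenO = (+),
     Ten = (\<lambda>X Y. cls n (ETen (rep X) (rep Y))),
     Tau = (\<lambda>j k. cls n (ETau j k))\<rparr>"

abbreviation TA :: nat where "TA \<equiv> Suc 0"
abbreviation TEta :: "nat \<Rightarrow> expr set" where "TEta n \<equiv> cls n EEta"
abbreviation TEps :: "nat \<Rightarrow> expr set" where "TEps n \<equiv> cls n EEps"
abbreviation TR :: "nat \<Rightarrow> expr set" where "TR n \<equiv> cls n ER"
abbreviation TS :: "nat \<Rightarrow> expr set" where "TS n \<equiv> cls n ES"


section \<open>Braids and blocked braids\<close>

inductive_set braid_factors :: "('o, 'a) bcat \<Rightarrow> 'o \<Rightarrow> 'a set" for C A where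
  "Idn C (tpow C A k) \<in> braid_factors C A"
| "Tau C A A \<in> braid_factors C A"
| "inv_arr C (Tau C A A) \<in> braid_factors C A"
| "f \<in> braid_factors C A \<Longrightarrow> g \<in> braid_factors C A \<Longrightarrow> f \<boxtimes>\<^bsub>C\<^esub> g \<in> braid_factors C A"

inductive_set braids :: "('o, 'a) bcat \<Rightarrow> 'o \<Rightarrow> nat \<Rightarrow> 'a set" for C A n where
  "f \<in> braid_factors C A \<inter> Hom C (tpow C A n) (tpow C A n) \<Longrightarrow> f \<in> braids C A n"
| "f \<in> braids C A n \<Longrightarrow> g \<in> braids C A n \<Longrightarrow> f \<bullet>\<^bsub>C\<^esub> g \<in> braids C A n"

definition sigma :: "('o, 'a) bcat \<Rightarrow> 'o \<Rightarrow> nat \<Rightarrow> nat \<Rightarrow> 'a" where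
  "sigma C A n i =
     Idn C (tpow C A (i - 1)) \<boxtimes>\<^bsub>C\<^esub> Tau C A A \<boxtimes>\<^bsub>C\<^esub> Idn C (tpow C A (n - i - 1))"

text \<open>\<open>underlying_perm C A n B p\<close>: some expression of \<open>B\<close> as a composite of arrows
  \<open>\<sigma>\<^sub>i\<close> and \<open>\<sigma>\<^sub>i\<^sup>-\<^sup>1\<close> becomes \<open>p\<close> on replacing each of them by the transposition of \<open>i\<close> and \<open>i + 1\<close>.\<close>

inductive underlying_perm :: "('o, 'a) bcat \<Rightarrow> 'o \<Rightarrow> nat \<Rightarrow> 'a \<Rightarrow> (nat \<Rightarrow> nat) \<Rightarrow> bool"
  for C A n where
  "underlying_perm C A n (Idn C (tpow C A n)) id"
| "underlying_perm C A n B p \<Longrightarrow> 1 \<le> i \<Longrightarrow> i < n \<Longrightarrow>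
     underlying_perm C A n (sigma C A n i \<bullet>\<^bsub>C\<^esub> B) (transpose i (i + 1) \<circ> p)"
| "underlying_perm C A n B p \<Longrightarrow> 1 \<le> i \<Longrightarrow> i < n \<Longrightarrow>
     underlying_perm C A n (inv_arr C (sigma C A n i) \<bullet>\<^bsub>C\<^esub> B) (transpose i (i + 1) \<circ> p)"

abbreviation Braids :: "nat \<Rightarrow> expr set set" where
  "Braids n \<equiv> braids (Tangle n) TA n"

definition blocked :: "nat \<Rightarrow> expr set \<Rightarrow> expr set" where
  "blocked n B = TS n \<bullet>\<^bsub>Tangle n\<^esub> B \<bullet>\<^bsub>Tangle n\<^esub> TR n"

text \<open>The product does not depend on the chosen braids, see \<open>BB_mult\<close> below.\<close>

definition BB :: "nat \<Rightarrow> expr set monoid" where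
  "BB n = \<lparr>
     carrier = blocked n ` Braids n,
     mult = (\<lambda>x y. THE z. \<exists>B \<in> Braids n. \<exists>B' \<in> Braids n.
       x = blocked n B \<and> y = blocked n B' \<and> z = blocked n (B \<bullet>\<^bsub>Tangle n\<^esub> B')),
     one = blocked n (Idn (Tangle n) (tpow (Tangle n) TA n))\<rparr>"


section \<open>The syntactic category is a model\<close>

lemma eqv_wf: "eqv n f g \<Longrightarrow> wfe n f \<and> wfe n g \<and> src n f = src n g \<and> tgt n f = tgt n g"
  by (induction rule: eqv.induct) auto

lemma cls_eq: "wfe n f \<Longrightarrow> cls n f = cls n g \<longleftrightarrow> eqv n f g"
  unfolding cls_def by (auto intro: eqv.intros(1-3))

lemma cls_eqI: "eqv n f g \<Longrightarrow> cls n f = cls n g"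
  using cls_eq eqv_wf by blast

lemma rep_cls:
  assumes "wfe n f"
  shows "eqv n f (rep (cls n f))"
proof -
  have "f \<in> cls n f"
    using assms by (simp add: cls_def eqv_refl)
  then have "rep (cls n f) \<in> cls n f"
    unfolding rep_def by (rule someI)
  then show ?thesis
    by (simp add: cls_def)
qed

lemma Tangle_simps [simp]:
  "Ob (Tangle n) = UNIV" "Arr (Tangle n) = cls n ` {f. wfe n f}"
  "Idn (Tangle n) k = cls n (EId k)" "Unit (Tangle n) = 0"
  "j \<star>\<^bsub>Tangle n\<^esub> k = j + k" "Tau (Tangle n) j k = cls n (ETau j k)"
  by (simp_all add: Tangle_def)

lemma Tangle_dom_cod [simp]:
  assumes "wfe n f"
  shows "Dom (Tangle n) (cls n f) = src n f" "Cod (Tangle n) (cls n f) = tgt n f"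
  using eqv_wf[OF rep_cls[OF assms]] by (simp_all add: Tangle_def)

lemma Tangle_cmp [simp]:
  assumes "wfe n f" "wfe n g" "src n f = tgt n g"
  shows "cls n f \<bullet>\<^bsub>Tangle n\<^esub> cls n g = cls n (ECmp f g)"
  unfolding Tangle_def using assms by (simp, intro cls_eqI[symmetric] eqv_cmp rep_cls)

lemma Tangle_ten [simp]:
  assumes "wfe n f" "wfe n g"
  shows "cls n f \<boxtimes>\<^bsub>Tangle n\<^esub> cls n g = cls n (ETen f g)"
  unfolding Tangle_def using assms by (simp, intro cls_eqI[symmetric] eqv_ten rep_cls)

lemma Tangle_hom: "X \<in> Hom (Tangle n) a b \<longleftrightarrow> (\<exists>f. X = cls n f \<and> wfe n f \<and> src n f = a \<and> tgt n f = b)"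
  by (auto simp: Hom_def)

lemma Tangle_homI: "wfe n f \<Longrightarrow> src n f = a \<Longrightarrow> tgt n f = b \<Longrightarrow> cls n f \<in> Hom (Tangle n) a b"
  by (auto simp: Hom_def)

lemma Tangle_homE:
  assumes "X \<in> Hom (Tangle n) a b"
  obtains f where "X = cls n f" "wfe n f" "a = src n f" "b = tgt n f"
  using assms by (auto simp: Hom_def)

lemma tpow_Tangle [simp]: "tpow (Tangle n) (Suc 0) k = k"
  by (induction k) auto

lemma Tangle_tau_inverse: "is_inverse (Tangle n) (cls n (ETau j k)) (cls n (ETauInv j k))"
  unfolding is_inverse_def by (auto intro!: cls_eqI Tangle_homI intro: eqv.intros)

lemma Tangle_bsmc: "braided_strict_monoidal_category (Tangle n)"
proof
  show "\<And>a b. \<exists>g. is_inverse (Tangle n) (Tau (Tangle n) a b) g"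
    using Tangle_tau_inverse by auto
qed (auto elim!: Tangle_homE intro!: Tangle_homI
       simp: eqv.intros(6-13,16-18)[THEN cls_eqI])

lemma Tangle_model:
  "blocked_tangle_algebra (Tangle n) TA (TEta n) (TEps n) n (TR n) (TS n)"
proof -
  interpret braided_strict_monoidal_category "Tangle n" by (rule Tangle_bsmc)
  show ?thesis
  proof
    show "(TEps n \<boxtimes>\<^bsub>Tangle n\<^esub> Idn (Tangle n) TA) \<bullet>\<^bsub>Tangle n\<^esub> (Idn (Tangle n) TA \<boxtimes>\<^bsub>Tangle n\<^esub> TEta n)
        = Idn (Tangle n) TA"
      using cls_eqI[OF eqv.snake_left] by simp
    show "(Idn (Tangle n) TA \<boxtimes>\<^bsub>Tangle n\<^esub> TEps n) \<bullet>\<^bsub>Tangle n\<^esub> (TEta n \<boxtimes>\<^bsub>Tangle n\<^esub> Idn (Tangle n) TA)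
        = Idn (Tangle n) TA"
      using cls_eqI[OF eqv.snake_right] by simp
    show "TEps n \<bullet>\<^bsub>Tangle n\<^esub> Tau (Tangle n) TA TA = TEps n"
      using cls_eqI[OF eqv.eps_tau] by simp
    show "Tau (Tangle n) TA TA \<bullet>\<^bsub>Tangle n\<^esub> TEta n = TEta n"
      using cls_eqI[OF eqv.tau_eta] by simp
  qed (auto intro!: Tangle_homI)
qed


section \<open>The universal property\<close>

context braided_strict_monoidal_category
begin

lemma homD: "f \<in> Hom C a b \<Longrightarrow> f \<in> Arr C \<and> Dom C f = a \<and> Cod C f = b \<and> a \<in> Ob C \<and> b \<in> Ob C"
  using dom_cod by (auto simp: Hom_def)

lemma inv_arr_eq:
  assumes f: "f \<in> Arr C" and g: "is_inverse C f g"
  shows "inv_arr C f = g"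
  unfolding inv_arr_def
proof (rule the_equality[where P = "is_inverse C f"])
  fix h assume h: "is_inverse C f h"
  have ff: "f \<in> Hom C (Dom C f) (Cod C f)"
    using f by (simp add: Hom_def)
  have gh: "g \<in> Hom C (Cod C f) (Dom C f)" "h \<in> Hom C (Cod C f) (Dom C f)"
    using g h by (auto simp: is_inverse_def)
  have "h = (g \<bullet> f) \<bullet> h"
    using g cmp_idn(1)[OF gh(2)] by (simp add: is_inverse_def)
  also have "\<dots> = g \<bullet> (f \<bullet> h)"
    by (rule cmp_assoc[OF gh(1) ff gh(2)])
  also have "\<dots> = g"
    using h cmp_idn(2)[OF gh(1)] by (simp add: is_inverse_def)
  finally show "h = g" .
qed (fact g)

lemma inv_tau: "a \<in> Ob C \<Longrightarrow> b \<in> Ob C \<Longrightarrow> is_inverse C (Tau C a b) (inv_arr C (Tau C a b))"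
  using inv_arr_eq tau_iso homD[OF tau_hom] by metis

lemma inv_tau_props:
  assumes "a \<in> Ob C" "b \<in> Ob C"
  shows "inv_arr C (Tau C a b) \<in> Hom C (b \<star> a) (a \<star> b)"
    "inv_arr C (Tau C a b) \<bullet> Tau C a b = Idn C (a \<star> b)"
    "Tau C a b \<bullet> inv_arr C (Tau C a b) = Idn C (b \<star> a)"
  using inv_tau[OF assms] homD[OF tau_hom[OF assms]] by (auto simp: is_inverse_def)

lemma tpow_ob: "A \<in> Ob C \<Longrightarrow> tpow C A k \<in> Ob C"
  by (induction k) (auto simp: unit_ob tenO_ob)

lemma tpow_add: "A \<in> Ob C \<Longrightarrow> tpow C A (j + k) = tpow C A j \<star> tpow C A k"
  by (induction j) (auto simp: tenO_unit tpow_ob tenO_assoc)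

lemma tpow_1: "A \<in> Ob C \<Longrightarrow> tpow C A (Suc 0) = A"
  by (simp add: tenO_unit)

lemma tpow_2: "A \<in> Ob C \<Longrightarrow> tpow C A 2 = A \<star> A"
  by (simp add: numeral_2_eq_2 tenO_unit)

end

context blocked_tangle_algebra
begin

primrec evl :: "expr \<Rightarrow> 'b" where
  "evl (EId k) = Idn C (tpow C A k)"
| "evl (ECmp f g) = evl f \<bullet> evl g"
| "evl (ETen f g) = evl f \<boxtimes> evl g"
| "evl (ETau j k) = Tau C (tpow C A j) (tpow C A k)"
| "evl (ETauInv j k) = inv_arr C (Tau C (tpow C A j) (tpow C A k))"
| "evl EEta = \<eta>"
| "evl EEps = \<epsilon>"
| "evl ER = R"
| "evl ES = S"

lemmas tp = tpow_ob[OF A_ob] tpow_add[OF A_ob] tpow_1[OF A_ob] tpow_2[OF A_ob]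

lemma evl_hom: "wfe n f \<Longrightarrow> evl f \<in> Hom C (tpow C A (src n f)) (tpow C A (tgt n f))"
proof (induction f)
  case (ECmp f g)
  then show ?case by (auto intro: cmp_hom)
qed (use eta_hom eps_hom R_hom S_hom in \<open>auto simp: tp intro: idn_hom ten_hom tau_hom inv_tau_props\<close>)

lemma evl_arr: "wfe n f \<Longrightarrow> evl f \<in> Arr C"
  using evl_hom homD by blast

lemmas C_ax = cmp_assoc ten_cmp tau_natural eps_tau tau_eta ten_idn ten_assoc

lemma evl_eqv: "eqv n f g \<Longrightarrow> evl f = evl g"
proof (induction rule: eqv.induct)
  case (cmp_assoc f g h)
  then show ?case
    using evl_hom[of f] evl_hom[of g] evl_hom[of h] by (auto intro: C_ax(1))
next
  case (ten_cmp f g h k)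
  then show ?case
    using evl_hom[of f] evl_hom[of g] evl_hom[of h] evl_hom[of k] by (auto intro: C_ax(2))
next
  case (tau_natural f g)
  then show ?case
    using evl_hom[of f] evl_hom[of g] by (auto intro: C_ax(3))
next
  case snake_left
  then show ?case
    using snake(1) by (simp add: tp del: tpow.simps)
next
  case snake_right
  then show ?case
    using snake(2) by (simp add: tp del: tpow.simps)
next
  case eps_tau
  then show ?case
    using C_ax(4) by (simp add: tp del: tpow.simps)
next
  case tau_eta
  then show ?case
    using C_ax(5) by (simp add: tp del: tpow.simps)
qed (simp_all add: tp evl_arr cmp_idn[OF evl_hom] C_ax(6,7) ten_unit
      inv_tau_props tau_tenO_right tau_tenO_left)

lemma Tangle_free_ex:
  "\<exists>F G. strict_braided_functor (Tangle n) C F G \<and> F TA = A \<and>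
     G (TEta n) = \<eta> \<and> G (TEps n) = \<epsilon> \<and> G (TR n) = R \<and> G (TS n) = S"
proof (intro exI conjI)
  define G where "G X = evl (rep X)" for X
  have G: "G (cls n f) = evl f" if "wfe n f" for f
    unfolding G_def using evl_eqv[OF rep_cls[OF that]] by simp
  show "strict_braided_functor (Tangle n) C (tpow C A) G"
    unfolding strict_braided_functor_def
    by (auto simp: G tp evl_hom)
  show "tpow C A TA = A" "G (TEta n) = \<eta>" "G (TEps n) = \<epsilon>" "G (TR n) = R" "G (TS n) = S"
    by (simp_all add: G tp del: tpow.simps)
qed

lemma functor_eq_evl:
  assumes F: "strict_braided_functor (Tangle n) C F G" "F TA = A"
    and gen: "G (TEta n) = \<eta>" "G (TEps n) = \<epsilon>" "G (TR n) = R" "G (TS n) = S"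
  shows "F k = tpow C A k" "wfe n f \<Longrightarrow> G (cls n f) = evl f"
proof -
  have F0: "F 0 = Unit C" and Fadd: "F (j + k) = F j \<star> F k" for j k
    using F(1) by (auto simp: strict_braided_functor_def)
  show Fk: "F k = tpow C A k" for k
  proof (induction k)
    case (Suc k)
    then show ?case
      using Fadd[of 1 k] F(2) by simp
  qed (simp add: F0)
  have Gcmp: "G (cls n (ECmp f g)) = G (cls n f) \<bullet> G (cls n g)"
    if "wfe n f" "wfe n g" "src n f = tgt n g" for f g
    using F(1) that Tangle_cmp[OF that]
    unfolding strict_braided_functor_def by fastforce
  have Gten: "G (cls n (ETen f g)) = G (cls n f) \<boxtimes> G (cls n g)" if "wfe n f" "wfe n g" for f g
    using F(1) that Tangle_ten[OF that]
    unfolding strict_braided_functor_def by fastforce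
  have Gid: "G (cls n (EId k)) = Idn C (tpow C A k)"
    and Gtau: "G (cls n (ETau j k)) = Tau C (tpow C A j) (tpow C A k)" for j k
    using F(1) by (simp_all add: strict_braided_functor_def Fk)
  have Ghom: "G (cls n f) \<in> Hom C (tpow C A (src n f)) (tpow C A (tgt n f))" if "wfe n f" for f
    using F(1) that by (auto simp: strict_braided_functor_def Fk)
  have Ginv: "G (cls n (ETauInv j k)) = inv_arr C (Tau C (tpow C A j) (tpow C A k))" for j k
  proof (rule inv_arr_eq[symmetric])
    show "Tau C (tpow C A j) (tpow C A k) \<in> Arr C"
      using tau_hom[OF tp(1) tp(1)] homD by blast
    have "G (cls n (ECmp (ETau j k) (ETauInv j k))) = G (cls n (EId (k + j)))"
      by (metis cls_eqI eqv.tau_inv_right)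
    moreover have "G (cls n (ECmp (ETauInv j k) (ETau j k))) = G (cls n (EId (j + k)))"
      by (metis cls_eqI eqv.tau_inv_left)
    ultimately show "is_inverse C (Tau C (tpow C A j) (tpow C A k)) (G (cls n (ETauInv j k)))"
      using Ghom[of "ETauInv j k"] homD[OF tau_hom[OF tp(1)[of j] tp(1)[of k]]]
      by (simp add: is_inverse_def Gcmp Gid Gtau tp)
  qed
  show "wfe n f \<Longrightarrow> G (cls n f) = evl f"
    by (induction f) (simp_all add: Gid Gcmp Gten Gtau Ginv gen)
qed

lemma Tangle_free_unique:
  assumes "strict_braided_functor (Tangle n) C F G" "F TA = A"
    "G (TEta n) = \<eta>" "G (TEps n) = \<epsilon>" "G (TR n) = R" "G (TS n) = S"
  and "strict_braided_functor (Tangle n) C F' G'" "F' TA = A"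
    "G' (TEta n) = \<eta>" "G' (TEps n) = \<epsilon>" "G' (TR n) = R" "G' (TS n) = S"
  shows "F = F' \<and> (\<forall>X \<in> Arr (Tangle n). G X = G' X)"
  using functor_eq_evl[OF assms(1-6)] functor_eq_evl[OF assms(7-12)] by auto

end

definition tangle_functor where
  "tangle_functor n D A \<eta> \<epsilon> R S F G \<longleftrightarrow> strict_braided_functor (Tangle n) D F G \<and> F TA = A \<and>
     G (TEta n) = \<eta> \<and> G (TEps n) = \<epsilon> \<and> G (TR n) = R \<and> G (TS n) = S"

theorem Tangle_free:
  assumes "blocked_tangle_algebra D A \<eta> \<epsilon> n R S"
  shows "\<exists>F G. tangle_functor n D A \<eta> \<epsilon> R S F G"
    and "tangle_functor n D A \<eta> \<epsilon> R S F G \<Longrightarrow> tangle_functor n D A \<eta> \<epsilon> R S F' G' \<Longrightarrow>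
           F = F' \<and> (\<forall>X \<in> Arr (Tangle n). G X = G' X)"
proof -
  interpret blocked_tangle_algebra D A \<eta> \<epsilon> n R S
    by (fact assms)
  show "\<exists>F G. tangle_functor n D A \<eta> \<epsilon> R S F G"
    unfolding tangle_functor_def by (rule Tangle_free_ex)
  show "tangle_functor n D A \<eta> \<epsilon> R S F G \<Longrightarrow> tangle_functor n D A \<eta> \<epsilon> R S F' G' \<Longrightarrow>
           F = F' \<and> (\<forall>X \<in> Arr (Tangle n). G X = G' X)"
    unfolding tangle_functor_def by (elim conjE, rule Tangle_free_unique)
qed


section \<open>The product of blocked braids is well defined\<close>

lemma braid_hom: "B \<in> Braids n \<Longrightarrow> B \<in> Hom (Tangle n) n n"
proof (induction rule: braids.induct)
  case (2 f g)
  then show ?case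
    using braided_strict_monoidal_category.cmp_hom[OF Tangle_bsmc] by blast
qed simp

lemma inv_tau_Tangle: "inv_arr (Tangle n) (cls n (ETau j k)) = cls n (ETauInv j k)"
  by (intro braided_strict_monoidal_category.inv_arr_eq Tangle_bsmc Tangle_tau_inverse) auto

lemma braid_factor_arr: "B \<in> braid_factors (Tangle n) TA \<Longrightarrow> B \<in> Arr (Tangle n)"
proof (induction rule: braid_factors.induct)
  case (4 f g)
  then show ?case by auto
qed (auto simp: inv_tau_Tangle)

lemma functor_fixes_braid:
  assumes F: "tangle_functor n (Tangle n) TA (TEta n) (TEps n) R S F G"
    and RS: "R \<in> Hom (Tangle n) 0 n" "S \<in> Hom (Tangle n) n 0"
    and B: "B \<in> Braids n"
  shows "G B = B"
proof -
  interpret blocked_tangle_algebra "Tangle n" TA "TEta n" "TEps n" n R S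
    using Tangle_model[of n] RS
    by (simp add: blocked_tangle_algebra_def blocked_tangle_algebra_axioms_def)
  have evl: "G (cls n f) = evl f" if "wfe n f" for f
    using functor_eq_evl(2)[of F G f] F that by (simp add: tangle_functor_def)
  have fac: "G B = B" if "B \<in> braid_factors (Tangle n) TA" for B
    using that
  proof (induction rule: braid_factors.induct)
    case (4 f g)
    then show ?case
      using F braid_factor_arr[of f n] braid_factor_arr[of g n]
      unfolding tangle_functor_def strict_braided_functor_def by metis
  qed (simp_all add: evl inv_tau_Tangle)
  show ?thesis
    using B
  proof (induction rule: braids.induct)
    case (2 f g)
    have "f \<in> Arr (Tangle n)" "g \<in> Arr (Tangle n)" "Dom (Tangle n) f = Cod (Tangle n) g"
      using braid_hom[OF 2(1)] braid_hom[OF 2(2)] by (simp_all add: Hom_def)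
    then have "G (f \<bullet>\<^bsub>Tangle n\<^esub> g) = G f \<bullet>\<^bsub>Tangle n\<^esub> G g"
      using F unfolding tangle_functor_def strict_braided_functor_def by blast
    with 2 show ?case by simp
  qed (simp add: fac)
qed

lemma blocked_substitute:
  assumes B: "B \<in> Braids n" "B' \<in> Braids n" and eq: "blocked n B = blocked n B'"
    and RS: "R \<in> Hom (Tangle n) 0 n" "S \<in> Hom (Tangle n) n 0"
  shows "S \<bullet>\<^bsub>Tangle n\<^esub> B \<bullet>\<^bsub>Tangle n\<^esub> R = S \<bullet>\<^bsub>Tangle n\<^esub> B' \<bullet>\<^bsub>Tangle n\<^esub> R"
proof -
  have "blocked_tangle_algebra (Tangle n) TA (TEta n) (TEps n) n R S"
    using Tangle_model[of n] RS
    by (simp add: blocked_tangle_algebra_def blocked_tangle_algebra_axioms_def)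
  from Tangle_free(1)[OF this]
  obtain F G where F: "tangle_functor n (Tangle n) TA (TEta n) (TEps n) R S F G"
    by (elim exE)
  have cmp: "G (X \<bullet>\<^bsub>Tangle n\<^esub> Y) = G X \<bullet>\<^bsub>Tangle n\<^esub> G Y"
    if "X \<in> Hom (Tangle n) b c" "Y \<in> Hom (Tangle n) a b" for X Y a b c
  proof -
    have "X \<in> Arr (Tangle n)" "Y \<in> Arr (Tangle n)" "Dom (Tangle n) X = Cod (Tangle n) Y"
      using that by (simp_all add: Hom_def)
    then show ?thesis
      using F unfolding tangle_functor_def strict_braided_functor_def by blast
  qed
  have val: "G (blocked n X) = S \<bullet>\<^bsub>Tangle n\<^esub> X \<bullet>\<^bsub>Tangle n\<^esub> R" if X: "X \<in> Braids n" for X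
  proof -
    have S: "TS n \<in> Hom (Tangle n) n 0" and R: "TR n \<in> Hom (Tangle n) 0 n"
      by (auto intro!: Tangle_homI)
    have "TS n \<bullet>\<^bsub>Tangle n\<^esub> X \<in> Hom (Tangle n) n 0"
      using braided_strict_monoidal_category.cmp_hom[OF Tangle_bsmc S braid_hom[OF X]] .
    then have "G (blocked n X) = G (TS n) \<bullet>\<^bsub>Tangle n\<^esub> G X \<bullet>\<^bsub>Tangle n\<^esub> G (TR n)"
      using cmp[OF _ R] cmp[OF S braid_hom[OF X]] by (simp add: blocked_def)
    then show ?thesis
      using F functor_fixes_braid[OF F RS X] by (simp add: tangle_functor_def)
  qed
  show ?thesis
    using val[OF B(1)] val[OF B(2)] eq by simp
qed

lemma blocked_cong:
  assumes B: "B1 \<in> Braids n" "B2 \<in> Braids n" "B1' \<in> Braids n" "B2' \<in> Braids n"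
    and eq: "blocked n B1 = blocked n B2" "blocked n B1' = blocked n B2'"
  shows "blocked n (B1 \<bullet>\<^bsub>Tangle n\<^esub> B1') = blocked n (B2 \<bullet>\<^bsub>Tangle n\<^esub> B2')"
proof -
  interpret T: braided_strict_monoidal_category "Tangle n" by (rule Tangle_bsmc)
  note h = B[THEN braid_hom]
  have S: "TS n \<in> Hom (Tangle n) n 0" and R: "TR n \<in> Hom (Tangle n) 0 n"
    by (auto intro!: Tangle_homI)
  have split: "blocked n (X \<bullet>\<^bsub>Tangle n\<^esub> Y) = TS n \<bullet>\<^bsub>Tangle n\<^esub> X \<bullet>\<^bsub>Tangle n\<^esub> (Y \<bullet>\<^bsub>Tangle n\<^esub> TR n)"
    "blocked n (X \<bullet>\<^bsub>Tangle n\<^esub> Y) = TS n \<bullet>\<^bsub>Tangle n\<^esub> X \<bullet>\<^bsub>Tangle n\<^esub> Y \<bullet>\<^bsub>Tangle n\<^esub> TR n"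
    if X: "X \<in> Hom (Tangle n) n n" and Y: "Y \<in> Hom (Tangle n) n n" for X Y
    unfolding blocked_def
    using T.cmp_assoc[OF S X Y] T.cmp_assoc[OF T.cmp_hom[OF S X] Y R] by simp_all
  have "blocked n (B1 \<bullet>\<^bsub>Tangle n\<^esub> B1') = blocked n (B2 \<bullet>\<^bsub>Tangle n\<^esub> B1')"
    using blocked_substitute[OF B(1,2) eq(1) T.cmp_hom[OF h(3) R] S] split(1) h by simp
  also have "\<dots> = blocked n (B2 \<bullet>\<^bsub>Tangle n\<^esub> B2')"
    using blocked_substitute[OF B(3,4) eq(2) R T.cmp_hom[OF S h(2)]] split(2) h by simp
  finally show ?thesis .
qed

theorem BB_mult:
  assumes "B \<in> Braids n" "B' \<in> Braids n"
  shows "blocked n B \<otimes>\<^bsub>BB n\<^esub> blocked n B' = blocked n (B \<bullet>\<^bsub>Tangle n\<^esub> B')"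
  unfolding BB_def monoid.simps
proof (rule the_equality)
  show "\<exists>B1 \<in> Braids n. \<exists>B1' \<in> Braids n. blocked n B = blocked n B1 \<and> blocked n B' = blocked n B1' \<and>
      blocked n (B \<bullet>\<^bsub>Tangle n\<^esub> B') = blocked n (B1 \<bullet>\<^bsub>Tangle n\<^esub> B1')"
    using assms by blast
qed (use assms blocked_cong in metis)

end

theory Submission
  imports Defs
begin

text \<open>
  Relations interpret the tangle category: the object \<open>k\<close> becomes the set of lists of length \<open>k\<close>
  over a set of labels, tensor becomes concatenation, the twist exchanges two blocks of a list, and
  \<open>\<eta>\<close>, \<open>\<epsilon>\<close> become the diagonal on labels and its converse. Since nothing is imposed on \<open>R\<close> and
  \<open>S\<close>, they may be interpreted as arbitrary lists \<open>r\<close> and \<open>s\<close> of length \<open>n\<close>. A braid only permutes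
  the labels, according to its underlying permutation, so \<open>S B R\<close> is the nonempty relation on the
  one-point set exactly if \<open>B\<close> carries \<open>r\<close> to \<open>s\<close>. Take \<open>r = [1, \<dots>, n]\<close>, whose entries are distinct, and
  let \<open>s\<close> be the list to which the permutation \<open>p\<close> carries \<open>r\<close>: the value of \<open>S B R\<close> then tells whether
  \<open>B\<close> has underlying permutation \<open>p\<close>. So equal blocked braids have equal permutations
  (\<open>blocked_determines_perm\<close>), the crucial facts being that the interpretation respects the
  defining equations (\<open>sem_eqv\<close>) and that it computes the permutation (\<open>sem_braid\<close>).

  This defines a map on all blocked braids because every braid is a composite of the \<open>\<sigma>\<^sub>i\<close> and their
  inverses (\<open>ex_underlying_perm\<close>). It is a homomorphism because composing such expressions composes
  the permutations (\<open>underlying_perm_cmp\<close>). It is surjective because adjacent transpositions generate the symmetric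
  group (\<open>permutes_underlying_perm\<close>).
\<close>

section \<open>Relational semantics\<close>

text \<open>Relations are needed for \<open>\<eta>\<close> and \<open>\<epsilon>\<close>: with functions instead, the left side of a snake equation
  would be constant. Symmetry of the diagonal gives \<open>\<epsilon>\<tau> = \<epsilon>\<close> and \<open>\<tau>\<eta> = \<eta>\<close>.\<close>

primrec sem :: "nat list \<Rightarrow> nat list \<Rightarrow> expr \<Rightarrow> (nat list \<times> nat list) set" where
  "sem r s (EId k) = {(xs, xs) | xs. length xs = k}"
| "sem r s (ECmp f g) = sem r s g O sem r s f"
| "sem r s (ETen f g) =
     {(xs @ xs', ys @ ys') | xs xs' ys ys'. (xs, ys) \<in> sem r s f \<and> (xs', ys') \<in> sem r s g}"
| "sem r s (ETau j k) = {(xs @ ys, ys @ xs) | xs ys. length xs = j \<and> length ys = k}"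
| "sem r s (ETauInv j k) = {(ys @ xs, xs @ ys) | xs ys. length xs = j \<and> length ys = k}"
| "sem r s EEta = {([], [x, x]) | x. True}"
| "sem r s EEps = {([x, x], []) | x. True}"
| "sem r s ER = {([], r)}"
| "sem r s ES = {(s, [])}"

lemma semI:
  "length xs = k \<Longrightarrow> (xs, xs) \<in> sem r s (EId k)"
  "(xs, ys) \<in> sem r s g \<Longrightarrow> (ys, zs) \<in> sem r s f \<Longrightarrow> (xs, zs) \<in> sem r s (ECmp f g)"
  "(xs, ys) \<in> sem r s f \<Longrightarrow> (xs', ys') \<in> sem r s g \<Longrightarrow>
     (xs @ xs', ys @ ys') \<in> sem r s (ETen f g)"
  "length xs = j \<Longrightarrow> length ys = k \<Longrightarrow> (xs @ ys, ys @ xs) \<in> sem r s (ETau j k)"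
  "length xs = j \<Longrightarrow> length ys = k \<Longrightarrow> (ys @ xs, xs @ ys) \<in> sem r s (ETauInv j k)"
  "([], [x, x]) \<in> sem r s EEta"
  "([x, x], []) \<in> sem r s EEps"
  by auto

lemma sem_length:
  assumes "length r = n" "length s = n"
  shows "wfe n f \<Longrightarrow> (xs, ys) \<in> sem r s f \<Longrightarrow> length xs = src n f \<and> length ys = tgt n f"
proof (induction f arbitrary: xs ys)
  case (ECmp f g)
  then show ?case by fastforce
next
  case (ETen f g)
  then show ?case by fastforce
qed (use assms in auto)

lemma split_length: "length xs = j + k \<longleftrightarrow> (\<exists>us vs. xs = us @ vs \<and> length us = j \<and> length vs = k)"
  by (metis add_diff_cancel_left' append_take_drop_id length_append length_drop length_take
      min.absorb2 le_add1)

text \<open>Soundness of the interpretation. Where an equation composes two tensor products, the middle list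
  is cut in two ways; typing (\<open>sem_length\<close>) makes the lengths of the pieces agree, hence the cuts.\<close>

lemma sem_eqv:
  assumes len: "length r = n" "length s = n"
  shows "eqv n f g \<Longrightarrow> sem r s f = sem r s g"
proof (induction rule: eqv.induct)
  case (ten_cmp f g h k)
  note L = sem_length[OF len]
  show ?case
  proof (intro equalityI subrelI)
    fix u v assume "(u, v) \<in> sem r s (ETen (ECmp f g) (ECmp h k))"
    then show "(u, v) \<in> sem r s (ECmp (ETen f h) (ETen g k))" by fastforce
  next
    fix u v assume "(u, v) \<in> sem r s (ECmp (ETen f h) (ETen g k))"
    then obtain xs xs' ys ys' zs zs' ws ws' where *: "u = xs @ xs'" "v = ws @ ws'"
      "ys @ ys' = zs @ zs'" "(xs, ys) \<in> sem r s g" "(xs', ys') \<in> sem r s k"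
      "(zs, ws) \<in> sem r s f" "(zs', ws') \<in> sem r s h" by auto
    have "length ys = length zs"
      using L[OF _ *(4)] L[OF _ *(6)] ten_cmp by simp
    with * show "(u, v) \<in> sem r s (ETen (ECmp f g) (ECmp h k))" by fastforce
  qed
next
  case (ten_assoc f g h)
  show ?case
  proof (intro equalityI subrelI)
    fix u v assume "(u, v) \<in> sem r s (ETen (ETen f g) h)"
    then show "(u, v) \<in> sem r s (ETen f (ETen g h))" by (auto, metis append.assoc)
  next
    fix u v assume "(u, v) \<in> sem r s (ETen f (ETen g h))"
    then show "(u, v) \<in> sem r s (ETen (ETen f g) h)" by (auto, metis append.assoc)
  qed
next
  case (tau_natural f g)
  note L = sem_length[OF len]
  show ?case
  proof (intro equalityI subrelI)
    fix u v assume "(u, v) \<in> sem r s (ECmp (ETau (tgt n f) (tgt n g)) (ETen f g))"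
    then obtain xs xs' ys ys' zs zs' where *: "u = xs @ xs'" "v = zs' @ zs"
      "ys @ ys' = zs @ zs'" "(xs, ys) \<in> sem r s f" "(xs', ys') \<in> sem r s g"
      "length zs = tgt n f" by auto
    have "length ys = length zs" "length xs = src n f" "length xs' = src n g"
      using L[OF _ *(4)] L[OF _ *(5)] *(6) tau_natural by simp_all
    with * show "(u, v) \<in> sem r s (ECmp (ETen g f) (ETau (src n f) (src n g)))" by fastforce
  next
    fix u v assume "(u, v) \<in> sem r s (ECmp (ETen g f) (ETau (src n f) (src n g)))"
    then obtain xs xs' zs zs' ws ws' where *: "u = xs @ xs'" "v = ws' @ ws"
      "xs' @ xs = zs' @ zs" "(zs, ws) \<in> sem r s f" "(zs', ws') \<in> sem r s g"
      "length xs' = src n g" by auto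
    have "length xs' = length zs'" "length ws = tgt n f" "length ws' = tgt n g"
      using L[OF _ *(4)] L[OF _ *(5)] *(6) tau_natural by simp_all
    with * show "(u, v) \<in> sem r s (ECmp (ETau (tgt n f) (tgt n g)) (ETen f g))" by fastforce
  qed
next
  case (id_left f)
  then show ?case by (auto simp: relcomp_unfold dest: sem_length[OF len])
next
  case (id_right f)
  then show ?case by (auto simp: relcomp_unfold dest: sem_length[OF len])
next
  case (ten_id j k)
  show ?case by (auto simp: split_length)
next
  case (tau_inv_left j k)
  show ?case
  proof (intro equalityI subrelI)
    fix u v assume "(u, v) \<in> sem r s (EId (j + k))"
    then obtain xs ys where "u = xs @ ys" "v = xs @ ys" "length xs = j" "length ys = k"
      by (auto dest: split_length[THEN iffD1])
    then show "(u, v) \<in> sem r s (ECmp (ETauInv j k) (ETau j k))" by fastforce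
  next
    fix u v assume "(u, v) \<in> sem r s (ECmp (ETauInv j k) (ETau j k))"
    then obtain xs ys xs' ys' where "u = xs @ ys" "ys @ xs = ys' @ xs'" "v = xs' @ ys'"
      "length xs = j" "length xs' = j" "length ys = k" "length ys' = k"
      by (simp only: sem.simps) blast
    then show "(u, v) \<in> sem r s (EId (j + k))" by simp
  qed
next
  case (tau_inv_right j k)
  show ?case
  proof (intro equalityI subrelI)
    fix u v assume "(u, v) \<in> sem r s (EId (k + j))"
    then obtain xs ys where "u = xs @ ys" "v = xs @ ys" "length xs = k" "length ys = j"
      by (auto dest: split_length[THEN iffD1])
    then show "(u, v) \<in> sem r s (ECmp (ETau j k) (ETauInv j k))" by fastforce
  next
    fix u v assume "(u, v) \<in> sem r s (ECmp (ETau j k) (ETauInv j k))"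
    then obtain xs ys xs' ys' where "u = xs @ ys" "ys @ xs = ys' @ xs'" "v = xs' @ ys'"
      "length xs = k" "length xs' = k" "length ys = j" "length ys' = j"
      by (simp only: sem.simps) blast
    then show "(u, v) \<in> sem r s (EId (k + j))" by simp
  qed
next
  case (tau_right i j k)
  show ?case
  proof (intro equalityI subrelI)
    fix u v assume "(u, v) \<in> sem r s (ETau i (j + k))"
    then obtain xs ys zs where "u = (xs @ ys) @ zs" "v = ys @ zs @ xs"
      and L: "length xs = i" "length ys = j" "length zs = k" by (auto dest!: split_length[THEN iffD1])
    moreover have "((xs @ ys) @ zs, (ys @ xs) @ zs) \<in> sem r s (ETen (ETau i j) (EId k))"
      "(ys @ xs @ zs, ys @ zs @ xs) \<in> sem r s (ETen (EId j) (ETau i k))" by (intro semI L)+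
    ultimately show "(u, v) \<in> sem r s (ECmp (ETen (EId j) (ETau i k)) (ETen (ETau i j) (EId k)))"
      by (auto intro: semI(2) simp del: sem.simps)
  next
    fix u v
    assume "(u, v) \<in> sem r s (ECmp (ETen (EId j) (ETau i k)) (ETen (ETau i j) (EId k)))"
    then obtain xs ys zs xs' ys' zs' where "u = (xs @ ys) @ zs"
      "(ys @ xs) @ zs = ys' @ xs' @ zs'" "v = ys' @ zs' @ xs'"
      and L: "length xs = i" "length ys = j" "length zs = k"
      and L': "length xs' = i" "length ys' = j" "length zs' = k"
      by (simp only: sem.simps) blast
    moreover have "(xs @ (ys @ zs), (ys @ zs) @ xs) \<in> sem r s (ETau i (j + k))"
      by (intro semI) (simp_all add: L)
    ultimately show "(u, v) \<in> sem r s (ETau i (j + k))" using L L' by (simp del: sem.simps)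
  qed
next
  case (tau_left i j k)
  show ?case
  proof (intro equalityI subrelI)
    fix u v assume "(u, v) \<in> sem r s (ETau (i + j) k)"
    then obtain xs ys zs where "u = xs @ ys @ zs" "v = (zs @ xs) @ ys"
      and L: "length xs = i" "length ys = j" "length zs = k" by (auto dest!: split_length[THEN iffD1])
    moreover have "(xs @ ys @ zs, xs @ zs @ ys) \<in> sem r s (ETen (EId i) (ETau j k))"
      "((xs @ zs) @ ys, (zs @ xs) @ ys) \<in> sem r s (ETen (ETau i k) (EId j))" by (intro semI L)+
    ultimately show "(u, v) \<in> sem r s (ECmp (ETen (ETau i k) (EId j)) (ETen (EId i) (ETau j k)))"
      by (auto intro: semI(2) simp del: sem.simps)
  next
    fix u v
    assume "(u, v) \<in> sem r s (ECmp (ETen (ETau i k) (EId j)) (ETen (EId i) (ETau j k)))"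
    then obtain xs ys zs xs' ys' zs' where "u = xs @ ys @ zs"
      "xs @ zs @ ys = (xs' @ zs') @ ys'" "v = (zs' @ xs') @ ys'"
      and L: "length xs = i" "length ys = j" "length zs = k"
      and L': "length xs' = i" "length ys' = j" "length zs' = k"
      by (simp only: sem.simps) blast
    moreover have "((xs @ ys) @ zs, zs @ (xs @ ys)) \<in> sem r s (ETau (i + j) k)"
      by (intro semI) (simp_all add: L)
    ultimately show "(u, v) \<in> sem r s (ETau (i + j) k)" using L L' by (simp del: sem.simps)
  qed
next
  case snake_left
  show ?case
  proof (intro equalityI subrelI)
    fix u v assume "(u, v) \<in> sem r s (EId 1)"
    then obtain x where "u = [x]" "v = [x]" by (auto simp: length_Suc_conv)
    moreover have "([x] @ [], [x] @ [x, x]) \<in> sem r s (ETen (EId 1) EEta)"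
      "([x, x] @ [x], [] @ [x]) \<in> sem r s (ETen EEps (EId 1))" by (intro semI; simp)+
    ultimately show "(u, v) \<in> sem r s (ECmp (ETen EEps (EId 1)) (ETen (EId 1) EEta))"
      by (auto intro: semI(2) simp del: sem.simps)
  qed (auto simp: length_Suc_conv)
next
  case snake_right
  show ?case
  proof (intro equalityI subrelI)
    fix u v assume "(u, v) \<in> sem r s (EId 1)"
    then obtain x where "u = [x]" "v = [x]" by (auto simp: length_Suc_conv)
    moreover have "([] @ [x], [x, x] @ [x]) \<in> sem r s (ETen EEta (EId 1))"
      "([x] @ [x, x], [x] @ []) \<in> sem r s (ETen (EId 1) EEps)" by (intro semI; simp)+
    ultimately show "(u, v) \<in> sem r s (ECmp (ETen (EId 1) EEps) (ETen EEta (EId 1)))"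
      by (auto intro: semI(2) simp del: sem.simps)
  qed (auto simp: length_Suc_conv)
next
  case eps_tau
  have *: "([x, x], [x, x]) \<in> sem r s (ETau 1 1)" for x
    using semI(4)[of "[x]" 1 "[x]" 1] by simp
  show ?case
  proof (intro equalityI subrelI)
    fix u v assume "(u, v) \<in> sem r s EEps"
    then obtain x where "u = [x, x]" "v = []" by auto
    then show "(u, v) \<in> sem r s (ECmp EEps (ETau 1 1))"
      using * by (auto intro: semI simp del: sem.simps(2,4))
  qed (auto simp: length_Suc_conv)
next
  case tau_eta
  have *: "([x, x], [x, x]) \<in> sem r s (ETau 1 1)" for x
    using semI(4)[of "[x]" 1 "[x]" 1] by simp
  show ?case
  proof (intro equalityI subrelI)
    fix u v assume "(u, v) \<in> sem r s EEta"
    then obtain x where "u = []" "v = [x, x]" by auto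
    then show "(u, v) \<in> sem r s (ECmp (ETau 1 1) EEta)"
      using * by (auto intro: semI simp del: sem.simps(2,4))
  qed (auto simp: length_Suc_conv)
next
  case (unit_left f)
  show ?case by simp
next
  case (unit_right f)
  show ?case by simp
qed (simp_all only: sem.simps O_assoc)


section \<open>Braids and their underlying permutations\<close>

context braided_strict_monoidal_category
begin

lemma is_inverse_ten:
  assumes "f \<in> Arr C" "is_inverse C f f'" "g \<in> Arr C" "is_inverse C g g'"
  shows "is_inverse C (f \<boxtimes> g) (f' \<boxtimes> g')"
proof -
  have f: "f \<in> Hom C (Dom C f) (Cod C f)" and g: "g \<in> Hom C (Dom C g) (Cod C g)"
    using assms by (simp_all add: Hom_def)
  have f': "f' \<in> Hom C (Cod C f) (Dom C f)" and g': "g' \<in> Hom C (Cod C g) (Dom C g)"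
    using assms by (simp_all add: is_inverse_def)
  have fg: "Dom C (f \<boxtimes> g) = Dom C f \<star> Dom C g" "Cod C (f \<boxtimes> g) = Cod C f \<star> Cod C g"
    using homD[OF ten_hom[OF f g]] by simp_all
  show ?thesis
    using assms(2,4) ten_hom[OF f' g'] ten_cmp[OF f f' g g', symmetric]
      ten_cmp[OF f' f g' g, symmetric] homD[OF f] homD[OF g]
    by (simp add: is_inverse_def fg ten_idn)
qed

lemma is_inverse_idn: "a \<in> Ob C \<Longrightarrow> is_inverse C (Idn C a) (Idn C a)"
  using idn_hom[of a] cmp_idn(1)[OF idn_hom[of a]] homD[OF idn_hom[of a]]
  by (simp add: is_inverse_def)

context
  fixes A
  assumes A: "A \<in> Ob C"
begin

abbreviation P where "P k \<equiv> tpow C A k"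

lemma tpow_facts: "P k \<in> Ob C" "P (j + k) = P j \<star> P k"
  by (rule tpow_ob[OF A], rule tpow_add[OF A])

lemma pad_hom:
  "f \<in> Hom C (P k) (P l) \<Longrightarrow>
     Idn C (P a) \<boxtimes> f \<boxtimes> Idn C (P b) \<in> Hom C (P (a + k + b)) (P (a + l + b))"
  by (auto simp: tpow_facts intro!: ten_hom idn_hom simp del: tpow.simps)

lemma tau_hom2: "Tau C A A \<in> Hom C (P 2) (P 2)"
  using tau_hom[OF A A] by (simp add: tpow_2[OF A])

lemma inv_tau_hom2: "inv_arr C (Tau C A A) \<in> Hom C (P 2) (P 2)"
  using inv_tau_props(1)[OF A A] by (simp add: tpow_2[OF A])

lemma sigma_eq:
  "m = a + 2 + b \<Longrightarrow> i = Suc a \<Longrightarrow>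
     sigma C A m i = Idn C (P a) \<boxtimes> Tau C A A \<boxtimes> Idn C (P b)"
  by (simp add: sigma_def)

lemma inv_sigma:
  assumes "m = a + 2 + b" "i = Suc a"
  shows "is_inverse C (sigma C A m i) (Idn C (P a) \<boxtimes> inv_arr C (Tau C A A) \<boxtimes> Idn C (P b))"
    and "inv_arr C (sigma C A m i) = Idn C (P a) \<boxtimes> inv_arr C (Tau C A A) \<boxtimes> Idn C (P b)"
proof -
  have arr: "Idn C (P a) \<in> Arr C" "Idn C (P b) \<in> Arr C" "Tau C A A \<in> Arr C"
    "Idn C (P a) \<boxtimes> Tau C A A \<in> Arr C"
    using idn_hom tpow_facts(1) tau_hom[OF A A] ten_hom homD by meson+
  show inv: "is_inverse C (sigma C A m i) (Idn C (P a) \<boxtimes> inv_arr C (Tau C A A) \<boxtimes> Idn C (P b))"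
    unfolding sigma_eq[OF assms]
    by (intro is_inverse_ten is_inverse_idn inv_tau arr tpow_facts(1) A)
  have "sigma C A m i \<in> Arr C"
    using homD[OF pad_hom[OF tau_hom2]] unfolding sigma_eq[OF assms] by blast
  then show "inv_arr C (sigma C A m i) = Idn C (P a) \<boxtimes> inv_arr C (Tau C A A) \<boxtimes> Idn C (P b)"
    using inv by (rule inv_arr_eq)
qed

lemma sigma_props:
  assumes "1 \<le> i" "i < m"
  shows sigma_hom: "sigma C A m i \<in> Hom C (P m) (P m)"
    and inv_sigma_hom: "inv_arr C (sigma C A m i) \<in> Hom C (P m) (P m)"
    and inv_sigma_left: "inv_arr C (sigma C A m i) \<bullet> sigma C A m i = Idn C (P m)"
    and inv_sigma_right: "sigma C A m i \<bullet> inv_arr C (sigma C A m i) = Idn C (P m)"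
    and sigma_braid: "sigma C A m i \<in> braids C A m"
    and inv_sigma_braid: "inv_arr C (sigma C A m i) \<in> braids C A m"
proof -
  define a b where "a = i - 1" and "b = m - i - 1"
  then have m: "m = a + 2 + b" and i: "i = Suc a"
    using assms by auto
  show 1: "sigma C A m i \<in> Hom C (P m) (P m)"
    using pad_hom[OF tau_hom2, of a b] by (simp only: sigma_eq[OF m i] m[symmetric])
  show 2: "inv_arr C (sigma C A m i) \<in> Hom C (P m) (P m)"
    using pad_hom[OF inv_tau_hom2, of a b] by (simp only: inv_sigma(2)[OF m i] m[symmetric])
  show "inv_arr C (sigma C A m i) \<bullet> sigma C A m i = Idn C (P m)"
    "sigma C A m i \<bullet> inv_arr C (sigma C A m i) = Idn C (P m)"
    using inv_sigma(1)[OF m i] homD[OF 1]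
    unfolding inv_sigma(2)[OF m i] by (simp_all add: is_inverse_def)
  have "sigma C A m i \<in> braid_factors C A"
    unfolding sigma_eq[OF m i] by (intro braid_factors.intros)
  moreover have "inv_arr C (sigma C A m i) \<in> braid_factors C A"
    unfolding inv_sigma(2)[OF m i] by (intro braid_factors.intros)
  ultimately show "sigma C A m i \<in> braids C A m" "inv_arr C (sigma C A m i) \<in> braids C A m"
    using 1 2 by (simp_all add: braids.intros(1))
qed

lemma idn_braid: "Idn C (P m) \<in> braids C A m"
  by (simp add: tpow_facts(1) braid_factors.intros(1) braids.intros(1) idn_hom)

lemma underlying_perm_braid: "underlying_perm C A m B p \<Longrightarrow> B \<in> braids C A m"
  by (induction rule: underlying_perm.induct)
    (blast intro: idn_braid braids.intros(2) sigma_braid inv_sigma_braid)+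

lemma underlying_perm_hom: "underlying_perm C A m B p \<Longrightarrow> B \<in> Hom C (P m) (P m)"
  by (induction rule: underlying_perm.induct)
    (blast intro: idn_hom tpow_facts(1) cmp_hom sigma_hom inv_sigma_hom)+

lemma underlying_perm_permutes: "underlying_perm C A m B p \<Longrightarrow> p permutes {1..m}"
proof (induction rule: underlying_perm.induct)
  case 1
  show ?case by (rule permutes_id)
next
  case (2 B p i)
  have "transpose i (i + 1) permutes {1..m}"
    using 2(2,3) by (intro permutes_swap_id) auto
  with 2(4) show ?case by (rule permutes_compose)
next
  case (3 B p i)
  have "transpose i (i + 1) permutes {1..m}"
    using 3(2,3) by (intro permutes_swap_id) auto
  with 3(4) show ?case by (rule permutes_compose)
qed

text \<open>The order of composition agrees: the expression for \<open>B \<bullet> B'\<close> has the letters of \<open>B\<close>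
  on the left, and so does the product of transpositions.\<close>

lemma underlying_perm_cmp:
  assumes "underlying_perm C A m B p" and B': "underlying_perm C A m B' p'"
  shows "underlying_perm C A m (B \<bullet> B') (p \<circ> p')"
  using assms(1)
proof (induction rule: underlying_perm.induct)
  case 1
  show ?case
    using B' cmp_idn(1)[OF underlying_perm_hom[OF B']] by simp
next
  case (2 B p i)
  then show ?case
    using underlying_perm.intros(2)[OF 2(4,2,3)]
      cmp_assoc[OF sigma_hom[OF 2(2,3)] underlying_perm_hom[OF 2(1)] underlying_perm_hom[OF B']]
    by (simp only: comp_assoc)
next
  case (3 B p i)
  then show ?case
    using underlying_perm.intros(3)[OF 3(4,2,3)]
      cmp_assoc[OF inv_sigma_hom[OF 3(2,3)] underlying_perm_hom[OF 3(1)] underlying_perm_hom[OF B']]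
    by (simp only: comp_assoc)
qed

lemma underlying_perm_sigma:
  assumes "1 \<le> i" "i < m"
  shows "underlying_perm C A m (sigma C A m i) (transpose i (i + 1))"
    "underlying_perm C A m (inv_arr C (sigma C A m i)) (transpose i (i + 1))"
  using underlying_perm.intros(2,3)[OF underlying_perm.intros(1) assms, of C A]
    cmp_idn(2)[OF sigma_hom[OF assms]] cmp_idn(2)[OF inv_sigma_hom[OF assms]]
  by (simp_all only: comp_id)

lemma underlying_perm_left_inverse:
  assumes "underlying_perm C A m B p"
  shows "\<exists>B' p'. underlying_perm C A m B' p' \<and> B' \<bullet> B = Idn C (P m)"
  using assms
proof (induction rule: underlying_perm.induct)
  case 1
  show ?case
    using underlying_perm.intros(1)[of C A m] cmp_idn(1)[OF idn_hom[OF tpow_facts(1)]] by blast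
next
  case (2 B p i)
  then obtain B' p' where B': "underlying_perm C A m B' p'" "B' \<bullet> B = Idn C (P m)" by blast
  note h = underlying_perm_hom[OF B'(1)] inv_sigma_hom[OF 2(2,3)] sigma_hom[OF 2(2,3)]
    underlying_perm_hom[OF 2(1)]
  have "(B' \<bullet> inv_arr C (sigma C A m i)) \<bullet> (sigma C A m i \<bullet> B) =
      B' \<bullet> ((inv_arr C (sigma C A m i) \<bullet> sigma C A m i) \<bullet> B)"
    using cmp_assoc[OF h(1,2) cmp_hom[OF h(3,4)]] cmp_assoc[OF h(2-4)] by simp
  also have "\<dots> = Idn C (P m)"
    using B'(2) inv_sigma_left[OF 2(2,3)] cmp_idn(1)[OF h(4)] by simp
  finally show ?case
    using underlying_perm_cmp[OF B'(1) underlying_perm_sigma(2)[OF 2(2,3)]] by blast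
next
  case (3 B p i)
  then obtain B' p' where B': "underlying_perm C A m B' p'" "B' \<bullet> B = Idn C (P m)" by blast
  note h = underlying_perm_hom[OF B'(1)] sigma_hom[OF 3(2,3)] inv_sigma_hom[OF 3(2,3)]
    underlying_perm_hom[OF 3(1)]
  have "(B' \<bullet> sigma C A m i) \<bullet> (inv_arr C (sigma C A m i) \<bullet> B) =
      B' \<bullet> ((sigma C A m i \<bullet> inv_arr C (sigma C A m i)) \<bullet> B)"
    using cmp_assoc[OF h(1,2) cmp_hom[OF h(3,4)]] cmp_assoc[OF h(2-4)] by simp
  also have "\<dots> = Idn C (P m)"
    using B'(2) inv_sigma_right[OF 3(2,3)] cmp_idn(1)[OF h(4)] by simp
  finally show ?case
    using underlying_perm_cmp[OF B'(1) underlying_perm_sigma(1)[OF 3(2,3)]] by blast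
qed

text \<open>The interchange law turns a tensor product of two braids into a composite of two braids, each of which
  moves only its own strings. This is what reduces general factors to the \<open>\<sigma>\<^sub>i\<close>.\<close>

lemma ten_split:
  assumes "f \<in> Hom C (P j) (P j)" "g \<in> Hom C (P k) (P k)"
  shows "Idn C (P a) \<boxtimes> (f \<boxtimes> g) \<boxtimes> Idn C (P b) =
    (Idn C (P a) \<boxtimes> f \<boxtimes> Idn C (P (k + b))) \<bullet> (Idn C (P (a + j)) \<boxtimes> g \<boxtimes> Idn C (P b))"
proof -
  note I = idn_hom[OF tpow_facts(1)] and Ob = tpow_facts(1)
  have arr: "f \<in> Arr C" "g \<in> Arr C" "\<And>k. Idn C (P k) \<in> Arr C"
    using assms I homD by blast+
  have t: "x \<boxtimes> y \<in> Arr C" if "x \<in> Arr C" "y \<in> Arr C" for x y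
    using that ten_hom[of x "Dom C x" "Cod C x" y "Dom C y" "Cod C y"] by (simp add: Hom_def)
  have "(Idn C (P a) \<boxtimes> f \<boxtimes> Idn C (P (k + b))) \<bullet> (Idn C (P (a + j)) \<boxtimes> g \<boxtimes> Idn C (P b))
      = ((Idn C (P a) \<boxtimes> f) \<boxtimes> (Idn C (P k) \<boxtimes> Idn C (P b))) \<bullet>
        ((Idn C (P a) \<boxtimes> Idn C (P j)) \<boxtimes> (g \<boxtimes> Idn C (P b)))"
    by (simp add: tpow_facts(2) ten_idn[OF Ob Ob, symmetric] ten_assoc arr t)
  also have "\<dots> = ((Idn C (P a) \<boxtimes> f) \<bullet> (Idn C (P a) \<boxtimes> Idn C (P j))) \<boxtimes>
      ((Idn C (P k) \<boxtimes> Idn C (P b)) \<bullet> (g \<boxtimes> Idn C (P b)))"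
    using ten_cmp[OF ten_hom[OF I assms(1)] ten_hom[OF I I] ten_hom[OF I I] ten_hom[OF assms(2) I]]
    by simp
  also have "\<dots> = ((Idn C (P a) \<bullet> Idn C (P a)) \<boxtimes> (f \<bullet> Idn C (P j))) \<boxtimes>
      ((Idn C (P k) \<bullet> g) \<boxtimes> (Idn C (P b) \<bullet> Idn C (P b)))"
    by (simp only: ten_cmp[OF I I assms(1) I] ten_cmp[OF I assms(2) I I])
  also have "\<dots> = Idn C (P a) \<boxtimes> (f \<boxtimes> g) \<boxtimes> Idn C (P b)"
    by (simp add: cmp_idn[OF I] cmp_idn[OF assms(1)] cmp_idn[OF assms(2)] ten_assoc arr t)
  finally show ?thesis by simp
qed

text \<open>The padding by identities on both sides is what lets the induction pass through tensor
  products: in \<open>f \<boxtimes> g\<close> each factor is padded by the strings of the other.\<close>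

lemma braid_factor_perm:
  assumes "f \<in> braid_factors C A"
  shows "\<exists>k. f \<in> Hom C (P k) (P k) \<and>
    (\<forall>a b. \<exists>p. underlying_perm C A (a + k + b) (Idn C (P a) \<boxtimes> f \<boxtimes> Idn C (P b)) p)"
  using assms
proof (induction rule: braid_factors.induct)
  case (1 k)
  have "Idn C (P a) \<boxtimes> Idn C (P k) \<boxtimes> Idn C (P b) = Idn C (P (a + k + b))" for a b
    using ten_idn tpow_facts(1,2) tenO_ob by metis
  then show ?case
    using idn_hom[OF tpow_facts(1)] underlying_perm.intros(1) by metis
next
  case 2
  have "underlying_perm C A (a + 2 + b) (Idn C (P a) \<boxtimes> Tau C A A \<boxtimes> Idn C (P b))
      (transpose (Suc a) (Suc a + 1))" for a b
    using underlying_perm_sigma(1)[of "Suc a" "a + 2 + b"]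
    by (simp add: sigma_eq[OF refl refl, symmetric])
  then show ?case
    using tau_hom2 by blast
next
  case 3
  have "underlying_perm C A (a + 2 + b) (Idn C (P a) \<boxtimes> inv_arr C (Tau C A A) \<boxtimes> Idn C (P b))
      (transpose (Suc a) (Suc a + 1))" for a b
    using underlying_perm_sigma(2)[of "Suc a" "a + 2 + b"]
    by (simp add: inv_sigma(2)[OF refl refl, symmetric])
  then show ?case
    using inv_tau_hom2 by blast
next
  case (4 f g)
  then obtain j k where f: "f \<in> Hom C (P j) (P j)"
      "\<And>a b. \<exists>p. underlying_perm C A (a + j + b) (Idn C (P a) \<boxtimes> f \<boxtimes> Idn C (P b)) p"
    and g: "g \<in> Hom C (P k) (P k)"
      "\<And>a b. \<exists>p. underlying_perm C A (a + k + b) (Idn C (P a) \<boxtimes> g \<boxtimes> Idn C (P b)) p"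
    by blast
  have "\<exists>p. underlying_perm C A (a + (j + k) + b) (Idn C (P a) \<boxtimes> (f \<boxtimes> g) \<boxtimes> Idn C (P b)) p" for a b
  proof -
    obtain p q where "underlying_perm C A (a + (j + k) + b) (Idn C (P a) \<boxtimes> f \<boxtimes> Idn C (P (k + b))) p"
      "underlying_perm C A (a + (j + k) + b) (Idn C (P (a + j)) \<boxtimes> g \<boxtimes> Idn C (P b)) q"
      using f(2)[of a "k + b"] g(2)[of "a + j" b] by (auto simp: add.assoc)
    then show ?thesis
      using underlying_perm_cmp ten_split[OF f(1) g(1)] by metis
  qed
  moreover have "f \<boxtimes> g \<in> Hom C (P (j + k)) (P (j + k))"
    using ten_hom[OF f(1) g(1)] by (simp add: tpow_facts(2))
  ultimately show ?case by blast
qed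

text \<open>Conjugating \<open>(a b)\<close> by the adjacent transposition \<open>(b b+1)\<close> gives \<open>(a b+1)\<close>.\<close>

lemma underlying_perm_transpose:
  "1 \<le> a \<Longrightarrow> a + Suc d \<le> m \<Longrightarrow> \<exists>B. underlying_perm C A m B (transpose a (a + Suc d))"
proof (induction d)
  case 0
  then show ?case
    using underlying_perm_sigma(1)[of a m] by auto
next
  case (Suc d)
  let ?b = "a + Suc d"
  obtain B where B: "underlying_perm C A m B (transpose a ?b)"
    using Suc by auto
  have s: "underlying_perm C A m (sigma C A m ?b) (transpose ?b (?b + 1))"
    using Suc.prems by (intro underlying_perm_sigma) auto
  have "transpose ?b (?b + 1) \<circ> transpose a ?b \<circ> transpose ?b (?b + 1) = transpose a (?b + 1)"
    by (auto simp: fun_eq_iff transpose_def)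
  then show ?case
    using underlying_perm_cmp[OF underlying_perm_cmp[OF s B] s]
    by (auto simp only: add_Suc_right add_0_right One_nat_def)
qed

lemma permutes_underlying_perm:
  assumes "p permutes {1..m}"
  shows "\<exists>B. underlying_perm C A m B p"
  using assms finite_atLeastAtMost
proof (induction rule: permutes_induct)
  case id
  show ?case using underlying_perm.intros(1)[of C A m] by blast
next
  case (swap a b p)
  then obtain B where B: "underlying_perm C A m B p" by blast
  have "\<exists>B. underlying_perm C A m B (transpose a b)"
  proof (cases a b rule: linorder_cases)
    case less
    then show ?thesis
      using underlying_perm_transpose[of a "b - Suc a" m] swap by simp
  next
    case equal
    then show ?thesis using underlying_perm.intros(1)[of C A m] by auto
  next
    case greater
    then show ?thesis
      using underlying_perm_transpose[of b "a - Suc b" m] swap by (simp add: transpose_commute)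
  qed
  with B show ?case using underlying_perm_cmp by blast
qed

end

end


section \<open>The underlying permutation of a blocked braid\<close>

lemma ex_underlying_perm:
  assumes "B \<in> Braids n"
  shows "\<exists>p. underlying_perm (Tangle n) TA n B p"
proof -
  interpret T: braided_strict_monoidal_category "Tangle n" by (rule Tangle_bsmc)
  have TA: "TA \<in> Ob (Tangle n)" by simp
  show ?thesis
    using assms
  proof (induction rule: braids.induct)
    case (1 f)
    then have f: "f \<in> Hom (Tangle n) n n" by simp
    obtain k where k: "f \<in> Hom (Tangle n) k k"
      "\<And>a b. \<exists>p. underlying_perm (Tangle n) TA (a + k + b)
         (Idn (Tangle n) a \<boxtimes>\<^bsub>Tangle n\<^esub> f \<boxtimes>\<^bsub>Tangle n\<^esub> Idn (Tangle n) b) p"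
      using T.braid_factor_perm[OF TA, of f] 1 unfolding tpow_Tangle by blast
    \<comment> \<open>Objects of the tangle category are numbers, so \<open>f\<close> determines its number of strings.\<close>
    have "k = n"
      using k(1) f by (simp add: Hom_def)
    moreover have "Idn (Tangle n) 0 \<boxtimes>\<^bsub>Tangle n\<^esub> f \<boxtimes>\<^bsub>Tangle n\<^esub> Idn (Tangle n) 0 = f"
      using T.ten_unit[of f] T.homD[OF f] by simp
    ultimately show ?case
      using k(2)[of 0 0] by simp
  next
    case (2 f g)
    then show ?case using T.underlying_perm_cmp[OF TA] by blast
  qed
qed

lemma sem_swap:
  assumes "length xs = j" "length ys = k" "e = ETau 1 1 \<or> e = ETauInv 1 1"
  shows "(xs @ [x, y] @ ys, zs) \<in> sem r s (ETen (ETen (EId j) e) (EId k)) \<longleftrightarrow> zs = xs @ [y, x] @ ys"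
proof -
  have e: "sem r s e = {([x, y], [y, x]) | x y :: nat. True}"
  proof (intro equalityI subrelI)
    fix u v assume "(u, v) \<in> {([x, y], [y, x]) | x y :: nat. True}"
    then obtain x y :: nat where "u = [x] @ [y]" "v = [y] @ [x]" by auto
    then show "(u, v) \<in> sem r s e"
      using assms(3) semI(4)[of "[x]" 1 "[y]" 1] semI(5)[of "[y]" 1 "[x]" 1] by force
  qed (use assms(3) in \<open>auto simp: length_Suc_conv\<close>)
  show ?thesis
  proof
    assume "zs = xs @ [y, x] @ ys"
    moreover have "((xs @ [x, y]) @ ys, (xs @ [y, x]) @ ys) \<in> sem r s (ETen (ETen (EId j) e) (EId k))"
      by (intro semI assms) (simp add: e)
    ultimately show "(xs @ [x, y] @ ys, zs) \<in> sem r s (ETen (ETen (EId j) e) (EId k))"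
      by (simp del: sem.simps)
  qed (use assms(1,2) in \<open>auto simp: e\<close>)
qed

text \<open>A list of labels at the positions \<open>1, \<dots>, n\<close> is written as the values of a function \<open>h\<close>, so that a
  crossing acts by precomposition with a transposition. Positive and negative crossings act alike.\<close>

lemma sem_sigma:
  fixes h :: "nat \<Rightarrow> nat"
  assumes "1 \<le> i" "i < n" "e = ETau 1 1 \<or> e = ETauInv 1 1"
  shows "(map h [1..<Suc n], zs) \<in> sem r s (ETen (ETen (EId (i - 1)) e) (EId (n - i - 1)))
    \<longleftrightarrow> zs = map (h \<circ> transpose i (i + 1)) [1..<Suc n]"
proof -
  have split: "[1..<Suc n] = [1..<i] @ [i, i + 1] @ [i + 2..<Suc n]"
    using assms(1,2) upt_add_eq_append[of 1 i "Suc n - i"] by (simp add: upt_conv_Cons)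
  have "map (h \<circ> transpose i (i + 1)) [1..<Suc n] =
      map h [1..<i] @ [h (i + 1), h i] @ map h [i + 2..<Suc n]"
    unfolding split by (auto simp: transpose_def)
  moreover have "map h [1..<Suc n] = map h [1..<i] @ [h i, h (i + 1)] @ map h [i + 2..<Suc n]"
    unfolding split by simp
  moreover have "length (map h [1..<i]) = i - 1" "length (map h [i + 2..<Suc n]) = n - i - 1"
    using assms(1,2) by (simp_all del: upt_Suc)
  ultimately show ?thesis
    using sem_swap[OF _ _ assms(3)] by metis
qed

lemma sigma_Tangle:
  assumes "1 \<le> i" "i < n"
  shows "sigma (Tangle n) TA n i = cls n (ETen (ETen (EId (i - 1)) (ETau 1 1)) (EId (n - i - 1)))"
    and "inv_arr (Tangle n) (sigma (Tangle n) TA n i) =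
      cls n (ETen (ETen (EId (i - 1)) (ETauInv 1 1)) (EId (n - i - 1)))"
proof -
  interpret T: braided_strict_monoidal_category "Tangle n" by (rule Tangle_bsmc)
  have "n = (i - 1) + 2 + (n - i - 1)" "i = Suc (i - 1)"
    using assms by auto
  from T.inv_sigma(2)[OF _ this, of TA]
  show "inv_arr (Tangle n) (sigma (Tangle n) TA n i) =
      cls n (ETen (ETen (EId (i - 1)) (ETauInv 1 1)) (EId (n - i - 1)))"
    by (simp add: inv_tau_Tangle)
qed (simp add: sigma_def)

text \<open>Replacing \<open>p\<close> by \<open>(i i+1) \<circ> p\<close> composes the inverse with the transposition on the right, which is how
  \<open>sem_sigma\<close> changes the list; so the list of labels after \<open>B\<close> records the inverse of \<open>p\<close>.\<close>

lemma sem_braid: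
  assumes "underlying_perm (Tangle n) TA n B p" "length s = n"
  shows "\<exists>b. B = cls n b \<and> wfe n b \<and> src n b = n \<and> tgt n b = n \<and>
    (\<forall>zs. ([1..<Suc n], zs) \<in> sem [1..<Suc n] s b \<longleftrightarrow> zs = map (inv' p) [1..<Suc n])"
proof -
  interpret T: braided_strict_monoidal_category "Tangle n" by (rule Tangle_bsmc)
  have step: "\<exists>b. X \<bullet>\<^bsub>Tangle n\<^esub> B = cls n b \<and> wfe n b \<and> src n b = n \<and> tgt n b = n \<and>
      (\<forall>zs. ([1..<Suc n], zs) \<in> sem [1..<Suc n] s b \<longleftrightarrow>
         zs = map (inv' (transpose i (i + 1) \<circ> p)) [1..<Suc n])"
    if B: "underlying_perm (Tangle n) TA n B p"
      and IH: "\<exists>b. B = cls n b \<and> wfe n b \<and> src n b = n \<and> tgt n b = n \<and>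
        (\<forall>zs. ([1..<Suc n], zs) \<in> sem [1..<Suc n] s b \<longleftrightarrow> zs = map (inv' p) [1..<Suc n])"
      and i: "1 \<le> i" "i < n"
      and X: "X = cls n (ETen (ETen (EId (i - 1)) e) (EId (n - i - 1)))"
      and e: "e = ETau 1 1 \<or> e = ETauInv 1 1" for B p i X e
  proof -
    let ?x = "ETen (ETen (EId (i - 1)) e) (EId (n - i - 1))"
    obtain b where b: "B = cls n b" "wfe n b" "src n b = n" "tgt n b = n"
      "\<And>zs. ([1..<Suc n], zs) \<in> sem [1..<Suc n] s b \<longleftrightarrow> zs = map (inv' p) [1..<Suc n]"
      using IH by blast
    have x: "wfe n ?x" "src n ?x = n" "tgt n ?x = n"
      using e i by auto
    have "bij p"
      using T.underlying_perm_permutes[OF _ B] permutes_bij by auto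
    then have "inv' (transpose i (i + 1) \<circ> p) = inv' p \<circ> transpose i (i + 1)"
      by (simp add: o_inv_distrib)
    moreover have "([1..<Suc n], zs) \<in> sem [1..<Suc n] s (ECmp ?x b) \<longleftrightarrow>
        (map (inv' p) [1..<Suc n], zs) \<in> sem [1..<Suc n] s ?x" for zs
      using b(5) by (auto simp del: sem.simps(3) upt_Suc)
    ultimately have "([1..<Suc n], zs) \<in> sem [1..<Suc n] s (ECmp ?x b) \<longleftrightarrow>
        zs = map (inv' (transpose i (i + 1) \<circ> p)) [1..<Suc n]" for zs
      using sem_sigma[OF i e] by simp
    moreover have "X \<bullet>\<^bsub>Tangle n\<^esub> B = cls n (ECmp ?x b)"
      unfolding X b(1) using x b by (intro Tangle_cmp) auto
    ultimately show ?thesis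
      using x b by (intro exI[of _ "ECmp ?x b"]) simp
  qed
  show ?thesis
    using assms(1)
  proof (induction rule: underlying_perm.induct)
    case 1
    show ?case by (rule exI[of _ "EId n"]) auto
  next
    case (2 B p i)
    then show ?case using step[OF _ _ _ _ sigma_Tangle(1)] by blast
  next
    case (3 B p i)
    then show ?case using step[OF _ _ _ _ sigma_Tangle(2)] by blast
  qed
qed

text \<open>The list \<open>s\<close> that interprets \<open>S\<close> depends on \<open>p\<close>: it is the one that makes \<open>S B R\<close>
  relate the empty list to itself. The same must then hold for \<open>B'\<close>.\<close>

theorem blocked_determines_perm:
  assumes B: "underlying_perm (Tangle n) TA n B p" and B': "underlying_perm (Tangle n) TA n B' p'"
    and eq: "blocked n B = blocked n B'"
  shows "p = p'"
proof -
  interpret T: braided_strict_monoidal_category "Tangle n" by (rule Tangle_bsmc)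
  let ?r = "[1..<Suc n]"
  let ?s = "map (inv' p) ?r"
  have len: "length ?r = n" "length ?s = n" by simp_all
  obtain b where b: "B = cls n b" "wfe n b" "src n b = n" "tgt n b = n"
    "(?r, ?s) \<in> sem ?r ?s b"
    using sem_braid[OF B len(2)] by blast
  obtain b' where b': "B' = cls n b'" "wfe n b'" "src n b' = n" "tgt n b' = n"
    "(?r, ?s) \<in> sem ?r ?s b' \<longleftrightarrow> ?s = map (inv' p') ?r"
    using sem_braid[OF B' len(2)] by blast
  have "eqv n (ECmp (ECmp ES b) ER) (ECmp (ECmp ES b') ER)"
    using eq b b' by (simp add: blocked_def cls_eq)
  then have "sem ?r ?s (ECmp (ECmp ES b) ER) = sem ?r ?s (ECmp (ECmp ES b') ER)"
    by (rule sem_eqv[OF len])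
  moreover have "([], []) \<in> sem ?r ?s (ECmp (ECmp ES e) ER) \<longleftrightarrow> (?r, ?s) \<in> sem ?r ?s e" for e
    by (auto simp del: upt_Suc)
  ultimately have "?s = map (inv' p') ?r"
    using b(5) b'(5) by blast
  then have on: "inv' p x = inv' p' x" if "x \<in> {1..n}" for x
    using that by (auto simp del: upt_Suc)
  have p: "p permutes {1..n}" "p' permutes {1..n}"
    using T.underlying_perm_permutes B B' by auto
  then have "inv' p = inv' p'"
    using on permutes_not_in[OF permutes_inv] by (metis ext)
  then show ?thesis
    using p by (metis inv_inv_eq permutes_bij)
qed

lemma BB_group: "group (BB n)"
proof -
  interpret T: braided_strict_monoidal_category "Tangle n" by (rule Tangle_bsmc)
  have TA: "TA \<in> Ob (Tangle n)" by simp
  have one: "\<one>\<^bsub>BB n\<^esub> = blocked n (Idn (Tangle n) n)"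
    and carr: "carrier (BB n) = blocked n ` Braids n"
    by (simp_all add: BB_def)
  have id: "Idn (Tangle n) n \<in> Braids n"
    using T.idn_braid[OF TA, of n] unfolding tpow_Tangle .
  note cl = braids.intros(2)[of _ "Tangle n" TA n]
  show ?thesis
  proof (rule groupI)
    show "\<one>\<^bsub>BB n\<^esub> \<in> carrier (BB n)"
      unfolding one carr using id by blast
  next
    fix x y assume "x \<in> carrier (BB n)" "y \<in> carrier (BB n)"
    then show "x \<otimes>\<^bsub>BB n\<^esub> y \<in> carrier (BB n)"
      unfolding carr using cl by (auto simp: BB_mult)
  next
    fix x y z assume "x \<in> carrier (BB n)" "y \<in> carrier (BB n)" "z \<in> carrier (BB n)"
    then show "x \<otimes>\<^bsub>BB n\<^esub> y \<otimes>\<^bsub>BB n\<^esub> z = x \<otimes>\<^bsub>BB n\<^esub> (y \<otimes>\<^bsub>BB n\<^esub> z)"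
      unfolding carr using cl T.cmp_assoc[OF braid_hom braid_hom braid_hom]
      by (auto simp: BB_mult)
  next
    fix x assume "x \<in> carrier (BB n)"
    then show "\<one>\<^bsub>BB n\<^esub> \<otimes>\<^bsub>BB n\<^esub> x = x"
      unfolding carr one using T.cmp_idn(1)[OF braid_hom]
      by (auto simp: BB_mult[OF id] simp del: Tangle_simps)
  next
    fix x assume "x \<in> carrier (BB n)"
    then obtain B where B: "B \<in> Braids n" "x = blocked n B"
      unfolding carr by blast
    obtain B' p where B': "underlying_perm (Tangle n) TA n B' p"
      "B' \<bullet>\<^bsub>Tangle n\<^esub> B = Idn (Tangle n) n"
      using ex_underlying_perm[OF B(1)] T.underlying_perm_left_inverse[OF TA, of n B]
      unfolding tpow_Tangle by blast
    then have "B' \<in> Braids n"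
      using T.underlying_perm_braid[OF TA] by blast
    then show "\<exists>y \<in> carrier (BB n). y \<otimes>\<^bsub>BB n\<^esub> x = \<one>\<^bsub>BB n\<^esub>"
      using B'(2) BB_mult[of B' n B] B unfolding carr one by auto
  qed
qed

theorem mainTheorem2:
  fixes n :: nat
  assumes "n \<ge> 1"
  shows "(\<forall>B \<in> Braids n. \<forall>B' \<in> Braids n. \<forall>p p'.
            underlying_perm (Tangle n) TA n B p \<and> underlying_perm (Tangle n) TA n B' p' \<and>
            blocked n B = blocked n B' \<longrightarrow> p = p')
    \<and> (\<exists>\<phi>. group_hom (BB n) (sym_group n) \<phi>
         \<and> \<phi> ` carrier (BB n) = carrier (sym_group n)
         \<and> (\<forall>B \<in> Braids n. underlying_perm (Tangle n) TA n B (\<phi> (blocked n B)))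
         \<and> (\<forall>i. 1 \<le> i \<and> i < n \<longrightarrow>
              \<phi> (blocked n (sigma (Tangle n) TA n i)) = transpose i (i + 1)))"
proof -
  interpret T: braided_strict_monoidal_category "Tangle n" by (rule Tangle_bsmc)
  have TA: "TA \<in> Ob (Tangle n)" by simp
  define \<phi> where "\<phi> x = (THE p. \<exists>B. x = blocked n B \<and> underlying_perm (Tangle n) TA n B p)" for x
  have phi: "\<phi> (blocked n B) = p" if "underlying_perm (Tangle n) TA n B p" for B p
    unfolding \<phi>_def using that blocked_determines_perm by (intro the_equality) metis+
  have phi_perm: "underlying_perm (Tangle n) TA n B (\<phi> (blocked n B))" if "B \<in> Braids n" for B
    using ex_underlying_perm[OF that] phi by auto
  have carr: "carrier (BB n) = blocked n ` Braids n"
    by (simp add: BB_def)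
  have "\<phi> \<in> hom (BB n) (sym_group n)"
  proof (rule homI)
    show "\<phi> x \<in> carrier (sym_group n)" if "x \<in> carrier (BB n)" for x
      using that phi_perm T.underlying_perm_permutes[OF TA] unfolding carr sym_group_carrier by blast
  next
    fix x y assume "x \<in> carrier (BB n)" "y \<in> carrier (BB n)"
    then show "\<phi> (x \<otimes>\<^bsub>BB n\<^esub> y) = \<phi> x \<otimes>\<^bsub>sym_group n\<^esub> \<phi> y"
      unfolding carr sym_group_mult
      using BB_mult phi T.underlying_perm_cmp[OF TA phi_perm phi_perm] by auto
  qed
  moreover have "carrier (sym_group n) \<subseteq> \<phi> ` carrier (BB n)"
  proof
    fix p assume "p \<in> carrier (sym_group n)"
    then obtain B where B: "underlying_perm (Tangle n) TA n B p"
      using T.permutes_underlying_perm[OF TA] sym_group_carrier by blast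
    then show "p \<in> \<phi> ` carrier (BB n)"
      unfolding carr using phi[OF B] T.underlying_perm_braid[OF TA B] by blast
  qed
  moreover have "\<phi> (blocked n (sigma (Tangle n) TA n i)) = transpose i (i + 1)" if "1 \<le> i \<and> i < n" for i
    using that phi T.underlying_perm_sigma(1)[OF TA] by blast
  ultimately show ?thesis
    using blocked_determines_perm phi_perm group_hom.intro[OF BB_group sym_group_is_group]
    by (intro conjI exI[of _ \<phi>]) (auto simp: group_hom_axioms_def hom_def)
qed

end
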